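(* Let $\mathcal{S}$ be a set system (a finite family $S_1,\dots,S_k$ of finite sets, $k=|\mathcal{S}|$), let $P$ be a finite set (the pot) with $\bigcup \mathcal{S} \subseteq P$ and $|P| \geq |\mathcal{S}|$, and let $t \in \{1, \ldots, |\mathcal{S}|-1\}$. Then Fixer has a winning strategy against Breaker $\mathfrak{B}_t$ in the game described below (started from $\mathcal{S}$ with pot $P$) if and only if \[\Big|\bigcup \mathcal{W}\Big| \geq |\mathcal{W}| - \nu_t(\mathcal{W}) \quad \text{for every subfamily } \mathcal{W} \subseteq \mathcal{S}.\]
   Context: A set system is a finite family of finite sets; its members are treated as indexed positions, so modifying a member means replacing the set at that position. A transversal of a set system $\mathcal{S}$ is an injection $f:\mathcal{S}\to\bigcup\mathcal{S}$ with $f(S)\in S$ for each $S\in\mathcal{S}$. The game is played by Fixer and Breaker on the current set system, with the fixed pot $P$ satisfying $\bigcup\mathcal{S}\subseteq P$; players alternate, Fixer moving first. Fixer's move: pick $x \in P$ and a member $S$ of the current system with $x \notin S$, and replace $S$ by $(S \cup \{x\}) \setminus \{y\}$ for some $y \in S$. Breaker $\mathfrak{B}_t$'s reply: if Fixer modified $S$ by inserting $x$ and removing $y$, Breaker may pick at most $t$ members of the system other than (the modified) $S$ and modify each of them by swapping $x$ for $y$ or $y$ for $x$ (replacing one of these two elements in the set by the other). Fixer wins iff he can (after finitely many rounds) bring the set system to a state that has a transversal; otherwise Breaker wins. For $\mathcal{W}\subseteq\mathcal{S}$ and $x\in P$, the degree is $d_{\mathcal{W}}(x) := |\{S \in \mathcal{W}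 : x \in S\}|$, and the $t$-value of $\mathcal{W}$ is \[\nu_t(\mathcal{W}) := \sum_{x \in \bigcup \mathcal{W}} \left\lfloor \frac{d_{\mathcal{W}}(x) - 1}{t+1} \right\rfloor.\] *)

theory Defs
  imports Main
begin

text \<open>
  A set system is a family \<open>S :: 'i \<Rightarrow> 'a set\<close> on a finite index set \<open>I\<close>; a subfamily is
  the restriction of \<open>S\<close> to some \<open>W \<subseteq> I\<close>. Distinct positions may carry equal sets, and
  cardinalities and degrees count positions.
\<close>

definition is_transversal :: "'i set \<Rightarrow> ('i \<Rightarrow> 'a set) \<Rightarrow> ('i \<Rightarrow> 'a) \<Rightarrow> bool" where
  "is_transversal I S f \<longleftrightarrow> inj_on f I \<and> (\<forall>i\<in>I. f i \<in> S i)"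

definition fixer_move ::
  "'i set \<Rightarrow> 'a set \<Rightarrow> 'i \<Rightarrow> 'a \<Rightarrow> 'a \<Rightarrow> ('i \<Rightarrow> 'a set) \<Rightarrow> ('i \<Rightarrow> 'a set) \<Rightarrow> bool" where
  "fixer_move I P i x y S S' \<longleftrightarrow>
     i \<in> I \<and> x \<in> P \<and> x \<notin> S i \<and> y \<in> S i \<and> S' = S(i := (S i \<union> {x}) - {y})"

text \<open>
  Swapping replaces one of the two elements by the other, so it applies only to a set
  containing exactly one of them and preserves the size of the set.
\<close>

definition swapped :: "'a \<Rightarrow> 'a \<Rightarrow> 'a set \<Rightarrow> 'a set \<Rightarrow> bool" where
  "swapped x y A B \<longleftrightarrow>
     x \<in> A \<and> y \<notin> A \<and> B = (A \<union> {y}) - {x} \<or>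
     y \<in> A \<and> x \<notin> A \<and> B = (A \<union> {x}) - {y}"

definition breaker_reply ::
  "'i set \<Rightarrow> nat \<Rightarrow> 'i \<Rightarrow> 'a \<Rightarrow> 'a \<Rightarrow> ('i \<Rightarrow> 'a set) \<Rightarrow> ('i \<Rightarrow> 'a set) \<Rightarrow> bool" where
  "breaker_reply I t i x y S S' \<longleftrightarrow>
     (\<exists>J \<subseteq> I - {i}. card J \<le> t \<and>
        (\<forall>j\<in>J. swapped x y (S j) (S' j)) \<and>
        (\<forall>j. j \<notin> J \<longrightarrow> S' j = S j))"

text \<open>
  A derivation of \<open>fixer_wins I P t S\<close> is a winning strategy tree for Fixer from \<open>S\<close>: each
  node gives Fixer's move and branches over all replies of Breaker, and every branch is finite.
  The win condition is tested only after complete rounds, not between Fixer's move and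
  Breaker's reply.
\<close>

inductive fixer_wins :: "'i set \<Rightarrow> 'a set \<Rightarrow> nat \<Rightarrow> ('i \<Rightarrow> 'a set) \<Rightarrow> bool"
  for I :: "'i set" and P :: "'a set" and t :: nat where
  transversal: "is_transversal I S f \<Longrightarrow> fixer_wins I P t S"
| round: "fixer_move I P i x y S S' \<Longrightarrow>
    (\<And>S''. breaker_reply I t i x y S' S'' \<Longrightarrow> fixer_wins I P t S'') \<Longrightarrow>
    fixer_wins I P t S"

definition degree :: "('i \<Rightarrow> 'a set) \<Rightarrow> 'i set \<Rightarrow> 'a \<Rightarrow> nat" where
  "degree S W x = card {i \<in> W. x \<in> S i}"

text \<open>The operation \<open>div\<close> on \<open>int\<close> rounds down, so it is the floor of the quotient.\<close>

definition t_value :: "nat \<Rightarrow> ('i \<Rightarrow> 'a set) \<Rightarrow> 'i set \<Rightarrow> int" where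
  "t_value t S W = (\<Sum>x\<in>(\<Union>i\<in>W. S i). (int (degree S W x) - 1) div (int t + 1))"

end

theory Submission
  imports Defs
begin

text \<open>
  Since \<open>\<lfloor>(d - 1) / (t + 1)\<rfloor> + 1 = \<lceil>d / (t + 1)\<rceil>\<close> for \<open>d > 0\<close>, the condition says that the weight
  \<open>\<Sum>x\<in>P. \<lceil>d\<^sub>W(x) / (t + 1)\<rceil>\<close> of every \<open>W\<close> is at least \<open>|W|\<close>.

  If some \<open>W\<close> violates this, Breaker can always answer a move inside \<open>W\<close> without letting the
  weight of \<open>W\<close> grow, so no transversal is ever reached.

  Conversely, let the condition hold and let the maximum \<open>D\<close> of \<open>|W| - |\<Union>W|\<close> be positive (otherwise
  Hall's theorem applies). Let \<open>W\<close> be a largest and \<open>W\<^sub>0\<close> a smallest subfamily attaining \<open>D\<close>; by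
  submodularity \<open>W\<^sub>0\<close> lies in every subfamily attaining \<open>D\<close>. The weight of \<open>W\<^sub>0\<close> exceeds \<open>|\<Union>W\<^sub>0|\<close>, so
  some \<open>y\<close> lies in at least \<open>t + 2\<close> members of \<open>W\<^sub>0\<close>, and Fixer replaces \<open>y\<close> in one of them by some
  \<open>x \<in> P - \<Union>W\<close>. Breaker can neither remove all the other occurrences of \<open>y\<close> in \<open>W\<^sub>0\<close> nor undo the
  move, so \<open>W\<^sub>0\<close> and all subfamilies of \<open>W\<close> attaining \<open>D\<close> gain an element. By maximality of \<open>W\<close>,
  the families \<open>U\<close> disjoint from \<open>W\<close> have \<open>|\<Union>U - \<Union>W| > |U|\<close> unless empty, so even without \<open>x\<close> they
  contribute enough new elements. Hence the condition is preserved and \<open>D\<close> drops.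
\<close>

section \<open>Hall's theorem\<close>

text \<open>Strong induction on the number of positions, split by whether some nonempty proper
  subfamily is tight, that is, has exactly as many elements as members. Fixer has already won once
  the deficiency is 0.\<close>

lemma hall:
  fixes S :: "'i \<Rightarrow> 'a set"
  assumes "finite I" and "\<And>i. i \<in> I \<Longrightarrow> finite (S i)"
    and "\<And>W. W \<subseteq> I \<Longrightarrow> card W \<le> card (\<Union>i\<in>W. S i)"
  shows "\<exists>f. is_transversal I S f"
  using assms
proof (induction "card I" arbitrary: I S rule: less_induct)
  case less
  note fin = less.prems(1) and finS = less.prems(2) and H = less.prems(3)
  have finU: "finite (\<Union>i\<in>W. S i)" if "W \<subseteq> I" for W
    using that finS finite_subset[OF that fin] by (intro finite_UN_I) auto
  consider (empty) "I = {}"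
    | (tight) W where "W \<subset> I" "W \<noteq> {}" "card (\<Union>i\<in>W. S i) = card W"
    | (loose) "I \<noteq> {}" "\<forall>W. W \<subset> I \<longrightarrow> W \<noteq> {} \<longrightarrow> card (\<Union>i\<in>W. S i) \<noteq> card W"
    by blast
  then show ?case
  proof cases
    case empty
    then show ?thesis by (auto simp: is_transversal_def)
  next
    case loose
    then obtain i where i: "i \<in> I" by blast
    have "card {i} \<le> card (\<Union>j\<in>{i}. S j)" using H[of "{i}"] i by blast
    then have "S i \<noteq> {}" by auto
    then obtain x where x: "x \<in> S i" by blast
    \<comment> \<open>With no tight proper subfamily, every union has an element to spare, so an
      arbitrary \<open>x\<close> in \<open>S i\<close> can be reserved for \<open>i\<close> and
      deleted everywhere else.\<close>
    have "\<exists>f. is_transversal (I - {i}) (\<lambda>j. S j - {x}) f"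
    proof (rule less.hyps)
      show "card (I - {i}) < card I" using fin i by (rule card_Diff1_less)
      fix W assume W: "W \<subseteq> I - {i}"
      show "card W \<le> card (\<Union>j\<in>W. S j - {x})"
      proof (cases "W = {}")
        case False
        have "W \<subset> I" using W i by blast
        then have "card (\<Union>j\<in>W. S j) \<noteq> card W" "card W \<le> card (\<Union>j\<in>W. S j)"
          using loose(2) False H[of W] by simp_all
        moreover have "(\<Union>j\<in>W. S j - {x}) = (\<Union>j\<in>W. S j) - {x}" by blast
        moreover have "card (\<Union>j\<in>W. S j) - 1 \<le> card ((\<Union>j\<in>W. S j) - {x})"
          by (simp only: card_Diff_singleton_if split: if_split) simp
        ultimately show ?thesis by simp
      qed simp
    qed (use fin finS in auto)
    then obtain f where f: "inj_on f (I - {i})" "\<forall>j\<in>I - {i}. f j \<in> S j - {x}"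
      unfolding is_transversal_def by blast
    have "is_transversal I S (f(i := x))"
      unfolding is_transversal_def
    proof
      show "inj_on (f(i := x)) I"
        using f by (auto simp: inj_on_def)
      show "\<forall>j\<in>I. (f(i := x)) j \<in> S j" using f x by auto
    qed
    then show ?thesis by blast
  next
    case tight
    define T where "T = (\<Union>i\<in>W. S i)"
    have WI: "W \<subseteq> I" and finW: "finite W" using tight fin finite_subset by auto
    have finT: "finite T" using finU WI by (simp add: T_def)
    have "\<exists>f. is_transversal W S f"
    proof (rule less.hyps)
      show "card W < card I" using tight fin by (simp add: psubset_card_mono)
    qed (use finW WI finS H in auto)
    then obtain f where f: "inj_on f W" "\<forall>j\<in>W. f j \<in> S j"
      unfolding is_transversal_def by blast
    \<comment> \<open>The tight \<open>W\<close> uses up all of \<open>T\<close>, so the rest must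
      be matched outside \<open>T\<close>. Hall's condition for \<open>U\<close> there is the one
      for \<open>U \<union> W\<close> with \<open>card T = card W\<close> subtracted.\<close>
    have "\<exists>g. is_transversal (I - W) (\<lambda>j. S j - T) g"
    proof (rule less.hyps)
      show "card (I - W) < card I" using tight fin WI by (intro psubset_card_mono) auto
      fix U assume U: "U \<subseteq> I - W"
      have "card U + card W = card (U \<union> W)"
        using U fin finW by (subst card_Un_disjoint) (auto intro: finite_subset)
      also have "\<dots> \<le> card (\<Union>j\<in>U \<union> W. S j)" using H[of "U \<union> W"] U WI by blast
      also have "(\<Union>j\<in>U \<union> W. S j) = (\<Union>j\<in>U. S j - T) \<union> T" by (auto simp: T_def)
      also have "card \<dots> \<le> card (\<Union>j\<in>U. S j - T) + card T" by (rule card_Un_le)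
      finally show "card U \<le> card (\<Union>j\<in>U. S j - T)" using tight(3) by (simp add: T_def)
    qed (use fin finS in auto)
    then obtain g where g: "inj_on g (I - W)" "\<forall>j\<in>I - W. g j \<in> S j - T"
      unfolding is_transversal_def by blast
    let ?h = "\<lambda>j. if j \<in> W then f j else g j"
    have fT: "f j \<in> T" if "j \<in> W" for j using f(2) that by (auto simp: T_def)
    have "inj_on ?h I"
    proof (rule inj_onI)
      fix j k assume jk: "j \<in> I" "k \<in> I" "?h j = ?h k"
      have "j \<in> W \<longleftrightarrow> k \<in> W" using jk fT g(2) by (metis DiffD2 DiffI)
      then show "j = k" using jk f(1) g(1) by (auto simp: inj_on_def split: if_splits)
    qed
    then have "is_transversal I S ?h"
      using f g by (auto simp: is_transversal_def)
    then show ?thesis by blast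
  qed
qed

section \<open>Degrees and weights\<close>

text \<open>\<open>(n + t) div (t + 1)\<close> is the ceiling of n/(t+1). This adjunction turns
  bounds on ceilings into bounds on multiples of \<open>t + 1\<close>.\<close>

lemma ceil_div_le_iff: "((n::nat) + t) div (t + 1) \<le> k \<longleftrightarrow> n \<le> k * (t + 1)"
proof -
  have "(n + t) div (t + 1) < k + 1 \<longleftrightarrow> n + t < (k + 1) * (t + 1)"
    by (rule div_less_iff_less_mult) simp
  then show ?thesis by (simp add: algebra_simps) linarith
qed

lemma ceil_div_add_le:
  "((a::nat) + b + t) div (t + 1) \<le> (a + t) div (t + 1) + (b + t) div (t + 1)"
proof -
  have "a \<le> (a + t) div (t + 1) * (t + 1)" "b \<le> (b + t) div (t + 1) * (t + 1)"
    using ceil_div_le_iff by blast+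
  then show ?thesis unfolding ceil_div_le_iff by (simp only: distrib_right)
qed

text \<open>Elements of degree 0 contribute \<open>t div (t + 1) = 0\<close>, so the sum can run
  over the fixed pot instead of a union that changes during play.\<close>

definition weight :: "nat \<Rightarrow> 'a set \<Rightarrow> ('i \<Rightarrow> 'a set) \<Rightarrow> 'i set \<Rightarrow> nat" where
  "weight t P S W = (\<Sum>x\<in>P. (degree S W x + t) div (t + 1))"

lemma degree_pos_iff: "finite W \<Longrightarrow> 0 < degree S W x \<longleftrightarrow> x \<in> (\<Union>i\<in>W. S i)"
  by (auto simp: degree_def card_gt_0_iff)

lemma degree_eq_0: "x \<notin> (\<Union>i\<in>W. S i) \<Longrightarrow> degree S W x = 0"
  unfolding degree_def by (metis (mono_tags, lifting) UN_I card.empty empty_Collect_eq)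

lemma degree_mono: "finite W \<Longrightarrow> A \<subseteq> W \<Longrightarrow> degree S A x \<le> degree S W x"
  unfolding degree_def by (rule card_mono) auto

lemma weight_eq_card_plus_t_value:
  assumes "finite P" "(\<Union>i\<in>W. S i) \<subseteq> P"
  shows "int (weight t P S W) = int (card (\<Union>i\<in>W. S i)) + t_value t S W"
proof -
  let ?U = "\<Union>i\<in>W. S i"
  have ceil: "int ((degree S W x + t) div (t + 1)) = 1 + (int (degree S W x) - 1) div (int t + 1)"
    if "x \<in> ?U" for x
  proof -
    have "int ((degree S W x + t) div (t + 1)) = ((int (degree S W x) - 1) + (int t + 1)) div (int t + 1)"
      by (simp add: zdiv_int ac_simps)
    also have "\<dots> = 1 + (int (degree S W x) - 1) div (int t + 1)"
      by (subst div_add_self2) auto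
    finally show ?thesis .
  qed
  have "weight t P S W = (\<Sum>x\<in>?U. (degree S W x + t) div (t + 1))"
    unfolding weight_def using assms
    by (intro sum.mono_neutral_right) (auto simp: degree_eq_0)
  then have "int (weight t P S W) = (\<Sum>x\<in>?U. 1 + (int (degree S W x) - 1) div (int t + 1))"
    using ceil by simp
  then show ?thesis by (simp add: t_value_def sum.distrib)
qed

lemma weight_split:
  assumes "finite P" "x \<in> P" "y \<in> P" "x \<noteq> y"
  shows "weight t P S W = (degree S W x + t) div (t + 1) + (degree S W y + t) div (t + 1)
    + (\<Sum>z\<in>P - {x, y}. (degree S W z + t) div (t + 1))"
proof -
  have "weight t P S W = (\<Sum>z\<in>{x, y}. (degree S W z + t) div (t + 1))
    + (\<Sum>z\<in>P - {x, y}. (degree S W z + t) div (t + 1))"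
    unfolding weight_def using assms by (subst add.commute, intro sum.subset_diff) auto
  then show ?thesis using assms by simp
qed

text \<open>A round changes only the degrees of \<open>x\<close> and \<open>y\<close>, so only their
  two terms need comparing. Breaker uses this to bound the new weight by the old, Fixer the old by
  the new.\<close>

lemma weight_le_if:
  assumes "finite P" "x \<in> P" "y \<in> P" "x \<noteq> y"
    and "\<And>z. z \<noteq> x \<Longrightarrow> z \<noteq> y \<Longrightarrow> degree T W z = degree S W z"
    and "(degree T W x + t) div (t + 1) + (degree T W y + t) div (t + 1)
      \<le> (degree S W x + t) div (t + 1) + (degree S W y + t) div (t + 1)"
  shows "weight t P T W \<le> weight t P S W"
  using assms by (simp add: weight_split)

text \<open>Used in contrapositive: a subfamily whose weight exceeds its union contains an element
  of degree at least \<open>t + 2\<close>.\<close>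

lemma weight_le_card_if_degree_le:
  assumes "finite P" "(\<Union>i\<in>W. S i) \<subseteq> P" "\<And>x. x \<in> P \<Longrightarrow> degree S W x \<le> t + 1"
  shows "weight t P S W \<le> card (\<Union>i\<in>W. S i)"
proof -
  let ?U = "\<Union>i\<in>W. S i"
  have "(degree S W x + t) div (t + 1) \<le> (if x \<in> ?U then 1 else 0)" if "x \<in> P" for x
    unfolding ceil_div_le_iff using assms(3)[OF that] degree_eq_0[of x S W] by simp
  then have "weight t P S W \<le> (\<Sum>x\<in>P. if x \<in> ?U then 1 else 0)"
    unfolding weight_def by (rule sum_mono)
  also have "\<dots> = (\<Sum>x\<in>?U. 1)"
    using assms(1,2) by (intro sum.mono_neutral_cong_right) auto
  finally show ?thesis by simp
qed

section \<open>Breaker's strategy\<close>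

text \<open>Breaker passes if the move is outside \<open>W\<close>. If a member of \<open>W\<close>
  contains \<open>x\<close> but not \<open>y\<close>, swapping there restores both degrees.
  Otherwise every member of \<open>W\<close> with \<open>x\<close> also has \<open>y\<close>, and
  Breaker turns further occurrences of \<open>y\<close> into \<open>x\<close>.\<close>

lemma breaker_keeps_weight:
  assumes "finite I" "finite P" "\<And>i. i \<in> I \<Longrightarrow> S i \<subseteq> P" "t \<ge> 1" "W \<subseteq> I"
    and move: "fixer_move I P i x y S S'"
  shows "\<exists>S''. breaker_reply I t i x y S' S'' \<and> weight t P S'' W \<le> weight t P S W"
proof -
  have i: "i \<in> I" "x \<in> P" "x \<notin> S i" "y \<in> S i" and S': "S' = S(i := (S i \<union> {x}) - {y})"
    using move by (auto simp: fixer_move_def)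
  have y: "y \<in> P" "x \<noteq> y" using i assms(3) by auto
  have finW: "finite W" using assms finite_subset by blast
  let ?c = "\<lambda>n. (n + t) div (t + 1)"
  let ?X = "{j \<in> W. x \<in> S j}" and ?Y = "{j \<in> W. y \<in> S j}"
  have finXY: "finite ?X" "finite ?Y" using finW by auto
  consider (out) "i \<notin> W" | (undo) k where "i \<in> W" "k \<in> W" "x \<in> S k" "y \<notin> S k"
    | (push) "i \<in> W" "?X \<subseteq> ?Y" by blast
  then show ?thesis
  proof cases
    case out
    have "breaker_reply I t i x y S' S'" by (auto simp: breaker_reply_def intro!: exI[of _ "{}"])
    moreover have "degree S' W z = degree S W z" for z
      unfolding degree_def S' using out by (intro arg_cong[where f = card]) auto
    ultimately show ?thesis by (auto simp: weight_def)
  next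
    case undo
    have ki: "k \<noteq> i" using undo i by blast
    define T where "T = S'(k := (S k \<union> {y}) - {x})"
    have "breaker_reply I t i x y S' T"
      unfolding breaker_reply_def swapped_def using undo ki assms(4,5)
      by (intro exI[of _ "{k}"]) (auto simp: T_def S')
    moreover have "weight t P T W \<le> weight t P S W"
    proof (rule weight_le_if[OF assms(2) i(2) y])
      fix z assume "z \<noteq> x" "z \<noteq> y"
      then show "degree T W z = degree S W z"
        unfolding degree_def by (intro arg_cong[where f = card]) (auto simp: T_def S')
    next
      have "{j \<in> W. x \<in> T j} = insert i (?X - {k})" "{j \<in> W. y \<in> T j} = insert k (?Y - {i})"
        using undo i ki y by (auto simp: T_def S')
      then have "degree T W x = degree S W x" "degree T W y = degree S W y"
        unfolding degree_def using undo i finXY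
        by (simp_all add: card_insert_if card_Suc_Diff1 del: card_Diff_insert)
      then show "?c (degree T W x) + ?c (degree T W y) \<le> ?c (degree S W x) + ?c (degree S W y)"
        by simp
    qed
    ultimately show ?thesis by blast
  next
    case push
    \<comment> \<open>Shifting by one puts the remainder \<open>r\<close> in 1..t+1, so the ceiling
      for \<open>y\<close> is \<open>p + 1\<close> and removing \<open>r\<close> occurrences lowers
      it to \<open>p\<close>.\<close>
    define p r where "p = (card ?Y - 1) div (t + 1)" and "r = (card ?Y - 1) mod (t + 1) + 1"
    \<comment> \<open>Fixer has already moved one occurrence, hence \<open>r - 1\<close>; the other
      bound counts the members besides \<open>i\<close> that contain \<open>y\<close> but not
      \<open>x\<close>.\<close>
    define m where "m = min (r - 1) (card ?Y - card ?X - 1)"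
    have iY: "i \<in> ?Y" "i \<notin> ?X" using push i by auto
    have ab: "card ?X < card ?Y" using push(2) iY finXY by (intro psubset_card_mono) auto
    have br: "card ?Y = p * (t + 1) + r" "r \<le> t + 1" "r \<ge> 1"
      using ab mod_less_divisor[of "t + 1" "card ?Y - 1"] div_mult_mod_eq[of "card ?Y - 1" "t + 1"]
      unfolding p_def r_def by linarith+
    have "card (?Y - ?X - {i}) = card ?Y - card ?X - 1"
      using push(2) iY finXY by (simp add: card_Diff_subset card_Diff_singleton)
    then have "m \<le> card (?Y - ?X - {i})" by (simp only: m_def min.cobounded2)
    then obtain J where J: "J \<subseteq> ?Y - ?X - {i}" "card J = m"
      by (rule obtain_subset_with_card_n)
    have finJ: "finite J" using J finXY finite_subset by blast
    define T where "T = (\<lambda>j. if j \<in> J then (S j \<union> {x}) - {y} else S' j)"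
    have "card J \<le> t" using J(2) br by (simp add: m_def)
    moreover have "J \<subseteq> I - {i}" using J assms(5) by blast
    ultimately have "breaker_reply I t i x y S' T"
      unfolding breaker_reply_def swapped_def using J
      by (intro exI[of _ J]) (auto simp: T_def S')
    moreover have "weight t P T W \<le> weight t P S W"
    proof (rule weight_le_if[OF assms(2) i(2) y])
      fix z assume "z \<noteq> x" "z \<noteq> y"
      then show "degree T W z = degree S W z"
        unfolding degree_def by (intro arg_cong[where f = card]) (auto simp: T_def S')
    next
      have iJ: "i \<notin> J" using J by blast
      have "{j \<in> W. x \<in> T j} = ?X \<union> insert i J"
        using J i y iJ push by (auto simp: T_def S')
      moreover have "card (?X \<union> insert i J) = card ?X + card (insert i J)"
        using J iY finXY finJ by (intro card_Un_disjoint) auto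
      ultimately have dx: "degree T W x = card ?X + m + 1"
        using iJ finJ J(2) by (simp add: degree_def)
      have "{j \<in> W. y \<in> T j} = ?Y - insert i J"
        using J i y iJ push by (auto simp: T_def S')
      moreover have "card (?Y - insert i J) = card ?Y - card (insert i J)"
        using J iY finJ by (intro card_Diff_subset) auto
      ultimately have dy: "degree T W y = card ?Y - (m + 1)"
        using iJ finJ J(2) by (simp add: degree_def)
      have d: "degree S W x = card ?X" "degree S W y = card ?Y" by (simp_all add: degree_def)
      show "?c (degree T W x) + ?c (degree T W y) \<le> ?c (degree S W x) + ?c (degree S W y)"
      \<comment> \<open>If \<open>r\<close> occurrences can be moved, the ceiling for
        \<open>y\<close> drops by one and that for \<open>x\<close> rises by at most one. If not,
        all available ones are moved and the two degrees trade places.\<close>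
      proof (cases "r \<le> card ?Y - card ?X")
        case True
        then have m: "m + 1 = r" using br(3) by (simp add: m_def)
        have "?c (card ?X + r) \<le> ?c (card ?X) + ?c r" by (rule ceil_div_add_le)
        moreover have "?c r \<le> 1" unfolding ceil_div_le_iff using br by simp
        moreover have "?c (card ?Y - r) \<le> p" unfolding ceil_div_le_iff using br by simp
        moreover have "\<not> ?c (card ?Y) \<le> p" unfolding ceil_div_le_iff using br by simp
        ultimately show ?thesis using m by (simp only: dx dy d add.assoc)
      next
        case False
        then have "card ?X + m + 1 = card ?Y" "card ?Y - (m + 1) = card ?X"
          using ab by (auto simp: m_def)
        then show ?thesis by (simp only: dx dy d)
      qed
    qed
    ultimately show ?thesis by blast
  qed
qed

lemma breaker_reply_subset_pot:
  assumes "fixer_move I P i x y S S'" "breaker_reply I t i x y S' S''"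
    and "\<And>j. j \<in> I \<Longrightarrow> S j \<subseteq> P" "j \<in> I"
  shows "S'' j \<subseteq> P"
proof -
  have m: "i \<in> I" "x \<in> P" "y \<in> S i" and S': "S' = S(i := (S i \<union> {x}) - {y})"
    using assms(1) by (auto simp: fixer_move_def)
  have y: "y \<in> P" using m assms(3) by blast
  have "S' j \<subseteq> P" using m y assms(3,4) by (auto simp: S')
  moreover have "S'' j = S' j \<or> swapped x y (S' j) (S'' j)"
    using assms(2) by (auto simp: breaker_reply_def)
  ultimately show ?thesis using m y by (auto simp: swapped_def)
qed

text \<open>Induction on the strategy tree, following the branch of Breaker's weight-keeping reply
  for the fixed \<open>W\<close>. At a leaf, the transversal supplies \<open>card W\<close> distinct
  elements of positive degree.\<close>

lemma fixer_wins_imp_weight_ge: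
  assumes "fixer_wins I P t S" "finite I" "finite P" "t \<ge> 1"
    and "\<And>i. i \<in> I \<Longrightarrow> S i \<subseteq> P" "W \<subseteq> I"
  shows "card W \<le> weight t P S W"
  using assms
proof (induction rule: fixer_wins.induct)
  case (transversal S f)
  have finW: "finite W" using transversal.prems finite_subset by blast
  have f: "inj_on f W" "\<And>j. j \<in> W \<Longrightarrow> f j \<in> S j"
    using transversal by (auto simp: is_transversal_def intro: inj_on_subset)
  have fP: "f ` W \<subseteq> P" using f transversal.prems by blast
  have "1 \<le> (degree S W x + t) div (t + 1)" if "x \<in> f ` W" for x
  proof -
    have "x \<in> (\<Union>j\<in>W. S j)" using that f(2) by blast
    then have "0 < degree S W x" unfolding degree_pos_iff[OF finW] .
    then have "\<not> (degree S W x + t) div (t + 1) \<le> 0" unfolding ceil_div_le_iff by simp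
    then show ?thesis by linarith
  qed
  then have "card (f ` W) * 1 \<le> (\<Sum>x\<in>f ` W. (degree S W x + t) div (t + 1))"
    using sum_bounded_below[of "f ` W" 1] by (metis of_nat_id)
  also have "\<dots> \<le> weight t P S W"
    unfolding weight_def using fP transversal.prems by (intro sum_mono2) auto
  finally show ?case using f(1) by (simp add: card_image)
next
  case (round i x y S S')
  obtain S'' where S'': "breaker_reply I t i x y S' S''" "weight t P S'' W \<le> weight t P S W"
    using breaker_keeps_weight[of I P S t W i x y S'] round by blast
  have "S'' j \<subseteq> P" if "j \<in> I" for j
    using breaker_reply_subset_pot[OF round.hyps(1) S''(1)] round.prems that by blast
  then have "card W \<le> weight t P S'' W" using round.IH[OF S''(1)] round.prems by blast
  then show ?case using S''(2) by linarith
qed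

section \<open>Fixer's strategy\<close>

text \<open>Fixer's own exchange is also a swap of \<open>x\<close> and \<open>y\<close>, so a whole
  round is at most \<open>t + 1\<close> swaps. Position \<open>i\<close> keeps \<open>x\<close>
  because Breaker may not touch it.\<close>

lemma round_effect:
  assumes "finite I" "fixer_move I P i x y S S'" "breaker_reply I t i x y S' S''"
  obtains J where "finite J" "card J \<le> t + 1" "\<And>j. j \<notin> J \<Longrightarrow> S'' j = S j"
    "\<And>j. j \<in> J \<Longrightarrow> swapped x y (S j) (S'' j)" "x \<in> S'' i"
proof -
  have m: "i \<in> I" "x \<notin> S i" "y \<in> S i" and S': "S' = S(i := (S i \<union> {x}) - {y})"
    using assms(2) by (auto simp: fixer_move_def)
  obtain J where J: "J \<subseteq> I - {i}" "card J \<le> t" "\<forall>j\<in>J. swapped x y (S' j) (S'' j)"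
      "\<forall>j. j \<notin> J \<longrightarrow> S'' j = S' j"
    using assms(3) by (auto simp: breaker_reply_def)
  have i: "S'' i = (S i \<union> {x}) - {y}" using J by (auto simp: S')
  have finJ: "finite J" using J assms(1) finite_subset by blast
  show thesis
  proof (rule that[of "insert i J"])
    show "card (insert i J) \<le> t + 1" using J(2) finJ by (simp add: card_insert_if)
    show "S'' j = S j" if "j \<notin> insert i J" for j using that J(4) by (simp add: S')
    show "swapped x y (S j) (S'' j)" if "j \<in> insert i J" for j
    proof (cases "j = i")
      case True
      then show ?thesis using m i by (auto simp: swapped_def)
    next
      case False
      then have "swapped x y (S' j) (S'' j)" using that J(3) by blast
      then show ?thesis using False by (simp add: S')
    qed
    show "x \<in> S'' i" using i m by auto
  qed (use finJ in simp)
qed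

text \<open>Without \<open>x\<close> in the members of \<open>A\<close>, a swap there can only turn
  \<open>y\<close> into \<open>x\<close>. Hence the old occurrences of \<open>y\<close> are divided
  between \<open>x\<close> and \<open>y\<close>.\<close>

lemma swap_effect_fresh:
  assumes "finite A" "x \<noteq> y" and fresh: "x \<notin> (\<Union>j\<in>A. S j)"
    and eff: "\<And>j. S'' j = S j \<or> swapped x y (S j) (S'' j)"
  shows "degree S'' A x + degree S'' A y = degree S A y"
    and "z \<noteq> x \<Longrightarrow> z \<noteq> y \<Longrightarrow> degree S'' A z = degree S A z"
    and "(\<Union>j\<in>A. S j) - {y} \<subseteq> (\<Union>j\<in>A. S'' j)"
    and "(\<Union>j\<in>A. S'' j) \<subseteq> insert x (\<Union>j\<in>A. S j)"
    and "y \<in> (\<Union>j\<in>A. S j) \<Longrightarrow> x \<in> (\<Union>j\<in>A. S'' j) \<or> y \<in> (\<Union>j\<in>A. S'' j)"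
proof -
  have xy: "x \<in> S'' j \<and> y \<notin> S'' j \<or> x \<notin> S'' j \<and> y \<in> S'' j" if "j \<in> A" "y \<in> S j" for j
    using eff[of j] assms(2) fresh that by (auto simp: swapped_def)
  have nxy: "x \<notin> S'' j \<and> y \<notin> S'' j" if "j \<in> A" "y \<notin> S j" for j
    using eff[of j] fresh that by (auto simp: swapped_def)
  have oth: "z \<in> S'' j \<longleftrightarrow> z \<in> S j" if "j \<in> A" "z \<noteq> x" "z \<noteq> y" for j z
    using eff[of j] that by (auto simp: swapped_def)
  have "{j \<in> A. y \<in> S j} = {j \<in> A. x \<in> S'' j} \<union> {j \<in> A. y \<in> S'' j}"
    using xy nxy by blast
  moreover have "{j \<in> A. x \<in> S'' j} \<inter> {j \<in> A. y \<in> S'' j} = {}" using xy nxy by blast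
  ultimately show "degree S'' A x + degree S'' A y = degree S A y"
    using assms(1) by (simp add: degree_def card_Un_disjoint)
  show "degree S'' A z = degree S A z" if "z \<noteq> x" "z \<noteq> y"
    unfolding degree_def using oth that by (intro arg_cong[where f = card]) auto
  show "(\<Union>j\<in>A. S j) - {y} \<subseteq> (\<Union>j\<in>A. S'' j)"
  proof
    fix z assume "z \<in> (\<Union>j\<in>A. S j) - {y}"
    then obtain j where "j \<in> A" "z \<in> S j" "z \<noteq> y" by blast
    then have "j \<in> A" "z \<in> S'' j" using oth[of j z] fresh by auto
    then show "z \<in> (\<Union>j\<in>A. S'' j)" by blast
  qed
  show "(\<Union>j\<in>A. S'' j) \<subseteq> insert x (\<Union>j\<in>A. S j)"
  proof
    fix z assume "z \<in> (\<Union>j\<in>A. S'' j)"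
    then obtain j where j: "j \<in> A" "z \<in> S'' j" by blast
    then have "z = x \<or> z \<in> S j" using oth[of j z] nxy[of j] by (cases "z = y") auto
    then show "z \<in> insert x (\<Union>j\<in>A. S j)" using j by blast
  qed
  show "x \<in> (\<Union>j\<in>A. S'' j) \<or> y \<in> (\<Union>j\<in>A. S'' j)" if "y \<in> (\<Union>j\<in>A. S j)"
    using that xy by blast
qed

text \<open>By \<open>def\<close> and \<open>ex\<close> the maximal deficiency is exactly
  \<open>Suc d\<close>. The move must work against every reply and keep the weight condition, so
  that it can be iterated.\<close>

lemma fixer_reduces_deficiency:
  assumes fin: "finite I" "finite P" and SP: "\<And>i. i \<in> I \<Longrightarrow> S i \<subseteq> P" and "card I \<le> card P"
    and wt: "\<And>W. W \<subseteq> I \<Longrightarrow> card W \<le> weight t P S W"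
    and def: "\<And>W. W \<subseteq> I \<Longrightarrow> card W \<le> card (\<Union>i\<in>W. S i) + Suc d"
    and ex: "B \<subseteq> I" "card B = card (\<Union>i\<in>B. S i) + Suc d"
  obtains i x y S' where "fixer_move I P i x y S S'"
    "\<And>S'' Z. breaker_reply I t i x y S' S'' \<Longrightarrow> Z \<subseteq> I \<Longrightarrow>
      card Z \<le> weight t P S'' Z \<and> card Z \<le> card (\<Union>i\<in>Z. S'' i) + d"
proof -
  let ?u = "\<lambda>W. \<Union>i\<in>W. S i"
  have finI: "finite W" if "W \<subseteq> I" for W using that fin finite_subset by blast
  have uP: "?u W \<subseteq> P" if "W \<subseteq> I" for W using that SP by blast
  have finu: "finite (?u W)" if "W \<subseteq> I" for W using uP[OF that] fin finite_subset by blast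
  define M where "M = {W. W \<subseteq> I \<and> card W = card (?u W) + Suc d}"
  have MI: "A \<subseteq> I" and Mc: "card A = card (?u A) + Suc d" if "A \<in> M" for A
    using that by (auto simp: M_def)
  have finM: "finite M" using fin by (simp add: M_def)
  have M_ne: "M \<noteq> {}" using ex by (auto simp: M_def)
  obtain W where W: "W \<in> M" "\<And>A. A \<in> M \<Longrightarrow> card A \<le> card W"
    using obtains_MAX[OF finM M_ne, of card] Max_ge finM by (metis finite_imageI image_eqI)
  obtain W0 where W0: "W0 \<in> M" "\<And>A. A \<in> M \<Longrightarrow> card W0 \<le> card A"
    using obtains_MIN[OF finM M_ne, of card] Min_le finM by (metis finite_imageI image_eqI)
  \<comment> \<open>Cardinality is modular and the size of a union submodular, so
    \<open>A \<inter> W0\<close> attains the maximum too; minimality of \<open>W0\<close> then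
    forces it to equal \<open>W0\<close>.\<close>
  have W0_le: "W0 \<subseteq> A" if A: "A \<in> M" for A
  proof -
    note I = MI[OF A] MI[OF W0(1)]
    have AW: "A \<inter> W0 \<subseteq> I" "A \<union> W0 \<subseteq> I" using I by auto
    have "card A + card W0 = card (A \<union> W0) + card (A \<inter> W0)"
      using finI[OF I(1)] finI[OF I(2)] by (rule card_Un_Int)
    moreover have "card (?u A) + card (?u W0) = card (?u A \<union> ?u W0) + card (?u A \<inter> ?u W0)"
      using finu[OF I(1)] finu[OF I(2)] by (rule card_Un_Int)
    moreover have "card (?u A \<union> ?u W0) = card (?u (A \<union> W0))"
      by (rule arg_cong[where f = card]) blast
    moreover have "card (?u (A \<inter> W0)) \<le> card (?u A \<inter> ?u W0)"
      using finu[OF I(1)] by (intro card_mono) auto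
    moreover note def[OF AW(1)] def[OF AW(2)] Mc[OF A] Mc[OF W0(1)]
    ultimately have "card (A \<inter> W0) = card (?u (A \<inter> W0)) + Suc d" by linarith
    then have "A \<inter> W0 \<in> M" using AW(1) by (simp add: M_def)
    then have "card W0 \<le> card (A \<inter> W0)" by (rule W0(2))
    then have "A \<inter> W0 = W0" using finI[OF I(2)] by (intro card_seteq) auto
    then show ?thesis by blast
  qed
  have WI: "W \<subseteq> I" "W0 \<subseteq> I" "W0 \<subseteq> W" using MI W W0 W0_le by auto
  \<comment> \<open>Otherwise \<open>W \<union> U\<close> would be a larger subfamily attaining the
    maximum. The strict inequality leaves one element to spare, which later pays for discarding
    \<open>x\<close>.\<close>
  have outside: "card U < card (?u U - ?u W)" if U: "U \<subseteq> I - W" "U \<noteq> {}" for U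
  proof -
    have UW: "W \<union> U \<subseteq> I" using U WI by blast
    have cU: "card (W \<union> U) = card W + card U"
      using U finI WI by (intro card_Un_disjoint) (auto intro: finI)
    have "card U > 0" using U finI[of U] by (auto simp: card_gt_0_iff)
    then have "W \<union> U \<notin> M" using W(2) cU by fastforce
    then have "card (W \<union> U) < card (?u (W \<union> U)) + Suc d"
      using def[OF UW] UW by (auto simp: M_def)
    moreover have "?u (W \<union> U) = ?u W \<union> (?u U - ?u W)" by blast
    moreover have "card (?u W \<union> (?u U - ?u W)) \<le> card (?u W) + card (?u U - ?u W)"
      by (rule card_Un_le)
    ultimately show ?thesis using cU Mc[OF W(1)] by simp
  qed
  have "card (?u W) < card P"
    using Mc[OF W(1)] card_mono[OF fin(1) WI(1)] assms(4) by linarith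
  then obtain x where x: "x \<in> P" "x \<notin> ?u W"
    using finu[OF WI(1)] by (metis card_mono leD subsetI)
  have "\<exists>y\<in>P. degree S W0 y > t + 1"
  proof (rule ccontr)
    assume "\<not> ?thesis"
    then have "weight t P S W0 \<le> card (?u W0)"
      by (intro weight_le_card_if_degree_le[OF fin(2) uP]) (use WI in auto)
    then show False using wt[OF WI(2)] Mc[OF W0(1)] by linarith
  qed
  then obtain y where y: "y \<in> P" "degree S W0 y > t + 1" by blast
  then have "y \<in> ?u W0" using degree_pos_iff[OF finI[OF WI(2)], of S y] by simp
  then obtain i where i: "i \<in> W0" "y \<in> S i" by blast
  have xy: "x \<noteq> y" using x i WI by blast
  have move: "fixer_move I P i x y S (S(i := (S i \<union> {x}) - {y}))"
    using i x WI by (auto simp: fixer_move_def)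
  show thesis
  proof (rule that[OF move])
    fix S'' Z
    assume reply: "breaker_reply I t i x y (S(i := (S i \<union> {x}) - {y})) S''" and Z: "Z \<subseteq> I"
    let ?v = "\<lambda>W. \<Union>i\<in>W. S'' i"
    obtain J where J: "finite J" "card J \<le> t + 1" "\<And>j. j \<notin> J \<Longrightarrow> S'' j = S j"
        "\<And>j. j \<in> J \<Longrightarrow> swapped x y (S j) (S'' j)" "x \<in> S'' i"
      using round_effect[OF fin(1) move reply] by blast
    have eff: "S'' j = S j \<or> swapped x y (S j) (S'' j)" for j using J(3,4) by blast
    have vP: "?v A \<subseteq> P" if "A \<subseteq> I" for A
      using breaker_reply_subset_pot[OF move reply SP] that by blast
    have finv: "finite (?v A)" if "A \<subseteq> I" for A using vP[OF that] fin finite_subset by blast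
    have xW0: "x \<in> ?v W0" using J(5) i by blast
    \<comment> \<open>More than \<open>t + 1\<close> members of \<open>W0\<close> contain
      \<open>y\<close>, and at most \<open>t + 1\<close> positions change.\<close>
    have yW0: "y \<in> ?v W0"
    proof -
      have "\<not> {j \<in> W0. y \<in> S j} \<subseteq> J"
        using card_mono[OF J(1), of "{j \<in> W0. y \<in> S j}"] y(2) J(2) by (auto simp: degree_def)
      then show ?thesis using J(3) by fastforce
    qed
    \<comment> \<open>Here \<open>x\<close> is fresh, so subadditivity of the ceiling keeps the
      weight from dropping. Subfamilies in \<open>M\<close> contain \<open>W0\<close>, hence keep
      \<open>y\<close> and gain \<open>x\<close>; for the others it suffices that the union does not
      shrink.\<close>
    have inside: "card A \<le> weight t P S'' A \<and> card A \<le> card (?v A) + d"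
      if A: "A \<subseteq> W" for A
    proof -
      have AI: "A \<subseteq> I" using A WI by blast
      have xA: "x \<notin> ?u A" using x A by blast
      note sw = swap_effect_fresh[OF finI[OF AI] xy xA eff]
      have d0: "degree S A x = 0" using x A by (intro degree_eq_0) blast
      have "weight t P S A \<le> weight t P S'' A"
      proof (rule weight_le_if[OF fin(2) x(1) y(1) xy])
        show "(degree S A x + t) div (t + 1) + (degree S A y + t) div (t + 1)
          \<le> (degree S'' A x + t) div (t + 1) + (degree S'' A y + t) div (t + 1)"
          using ceil_div_add_le[of "degree S'' A x" "degree S'' A y" t] sw(1) d0 by simp
      qed (use sw(2) in simp)
      moreover have "card A \<le> card (?v A) + d"
      proof (cases "A \<in> M")
        case True
        then have "insert x (?u A) \<subseteq> ?v A" using W0_le[OF True] xW0 yW0 sw(3) by blast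
        moreover note xA
        ultimately have "card (?u A) + 1 \<le> card (?v A)"
          using card_mono[OF finv[OF AI], of "insert x (?u A)"]
            card_insert_disjoint[OF finu[OF AI], of x] by linarith
        then show ?thesis using Mc[OF True] by linarith
      next
        case False
        then have "card A \<le> card (?u A) + d" using def[OF AI] AI by (auto simp: M_def)
        moreover have "card (?u A) \<le> card (?v A)"
        proof (cases "y \<in> ?u A")
          case yA: True
          \<comment> \<open>\<open>z\<close> is \<open>x\<close> or \<open>y\<close>, whichever
            survives, and fills the place of \<open>y\<close> in the count.\<close>
          then obtain z where "z \<in> ?v A" "z \<notin> ?u A - {y}" using sw(5) xA by blast
          then have "card (insert z (?u A - {y})) \<le> card (?v A)"
            using sw(3) finv[OF AI] by (intro card_mono) auto
          then show ?thesis
            using \<open>z \<notin> ?u A - {y}\<close> finu[OF AI] yA by (simp add: card_Suc_Diff1)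
        next
          case False
          then show ?thesis using sw(3) finv[OF AI] by (intro card_mono) auto
        qed
        ultimately show ?thesis by linarith
      qed
      ultimately show ?thesis using wt[OF AI] by linarith
    qed
    define A U where "A = Z \<inter> W" and "U = Z - W"
    \<comment> \<open>These elements are neither \<open>x\<close> nor \<open>y\<close>, so the round
      leaves them in place, and none of them lies in the new union over \<open>A\<close>. They
      therefore add \<open>card N\<close> to both the union and the weight of \<open>A\<close>,
      covering the members in \<open>U\<close>.\<close>
    define N where "N = ?u U - ?u W - {x}"
    have AI: "A \<subseteq> I" using Z by (auto simp: A_def)
    have cZ: "card Z = card A + card U"
      unfolding A_def U_def by (rule card_Int_Diff) (rule finI[OF Z])
    have UN: "card U \<le> card N"
    proof (cases "U = {}")
      case False
      then have "card U < card (?u U - ?u W)" using outside[of U] Z by (auto simp: U_def)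
      moreover have "card (?u U - ?u W) - 1 \<le> card N"
        unfolding N_def by (simp only: card_Diff_singleton_if split: if_split) simp
      ultimately show ?thesis by linarith
    qed simp
    have "x \<notin> ?u A" using x by (auto simp: A_def)
    from swap_effect_fresh(4)[OF finI[OF AI] xy this eff]
    have "?v A \<subseteq> insert x (?u A)" .
    moreover have "?u A \<subseteq> ?u W" by (auto simp: A_def)
    ultimately have NA: "N \<inter> ?v A = {}" unfolding N_def by blast
    have NZ: "N \<subseteq> ?v Z"
    proof
      fix z assume z: "z \<in> N"
      then obtain j where j: "j \<in> Z" "z \<in> S j" by (auto simp: N_def U_def)
      moreover have "z \<noteq> x" "z \<noteq> y" using z \<open>y \<in> ?u W0\<close> WI by (auto simp: N_def)
      ultimately have "z \<in> S'' j" using eff[of j] by (auto simp: swapped_def)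
      then show "z \<in> ?v Z" using j by blast
    qed
    have finN: "finite N" using NZ finv[OF Z] finite_subset by blast
    have NP: "N \<subseteq> P" using NZ vP[OF Z] by blast
    have AZ: "A \<subseteq> Z" by (simp add: A_def)
    have "card (?v A) + card N = card (?v A \<union> N)"
      using NA finN finv[OF AI] by (subst card_Un_disjoint) auto
    also have "\<dots> \<le> card (?v Z)"
      using NZ AZ finv[OF Z] by (intro card_mono) auto
    finally have cv: "card (?v A) + card N \<le> card (?v Z)" .
    have "weight t P S'' A + card N
      = (\<Sum>z\<in>P. (degree S'' A z + t) div (t + 1) + (if z \<in> N then 1 else 0))"
      using fin NP by (simp add: weight_def sum.distrib sum.If_cases Int_absorb1)
    also have "\<dots> \<le> weight t P S'' Z"
      unfolding weight_def
    proof (rule sum_mono)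
      fix z
      show "(degree S'' A z + t) div (t + 1) + (if z \<in> N then 1 else 0)
        \<le> (degree S'' Z z + t) div (t + 1)"
      proof (cases "z \<in> N")
        case True
        then have "degree S'' A z = 0" using NA by (intro degree_eq_0) blast
        moreover have "0 < degree S'' Z z"
          unfolding degree_pos_iff[OF finI[OF Z]] using NZ True by (rule subsetD)
        then have "\<not> (degree S'' Z z + t) div (t + 1) \<le> 0" unfolding ceil_div_le_iff by simp
        ultimately show ?thesis using True by simp
      next
        case False
        then show ?thesis
          using degree_mono[OF finI[OF Z] AZ, of S'' z] by (simp add: div_le_mono)
      qed
    qed
    finally have wv: "weight t P S'' A + card N \<le> weight t P S'' Z" .
    show "card Z \<le> weight t P S'' Z \<and> card Z \<le> card (?v Z) + d"
      using inside[of A] cZ UN cv wv by (auto simp: A_def)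
  qed
qed

text \<open>Induction on a bound \<open>d\<close> for the deficiency: a round is played only if the
  bound is attained, and at 0 Hall's theorem gives the transversal.\<close>

lemma weight_ge_imp_fixer_wins:
  assumes "finite I" "finite P" "\<And>i. i \<in> I \<Longrightarrow> S i \<subseteq> P" "card I \<le> card P"
    and "\<And>W. W \<subseteq> I \<Longrightarrow> card W \<le> weight t P S W"
    and "\<And>W. W \<subseteq> I \<Longrightarrow> card W \<le> card (\<Union>i\<in>W. S i) + d"
  shows "fixer_wins I P t S"
  using assms
proof (induction d arbitrary: S)
  case 0
  have "\<exists>f. is_transversal I S f"
    using 0 by (intro hall) (auto intro: finite_subset)
  then show ?case using fixer_wins.transversal by blast
next
  case (Suc d)
  show ?case
  proof (cases "\<exists>B\<subseteq>I. card B = card (\<Union>i\<in>B. S i) + Suc d")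
    case False
    then have "card W \<le> card (\<Union>i\<in>W. S i) + d" if "W \<subseteq> I" for W
      using Suc.prems(6)[OF that] that le_Suc_eq by auto
    then show ?thesis using Suc.IH Suc.prems(1-5) by blast
  next
    case True
    then obtain B where "B \<subseteq> I" "card B = card (\<Union>i\<in>B. S i) + Suc d" by blast
    then obtain i x y S' where move: "fixer_move I P i x y S S'"
      and reply: "\<And>S'' Z. breaker_reply I t i x y S' S'' \<Longrightarrow> Z \<subseteq> I \<Longrightarrow>
        card Z \<le> weight t P S'' Z \<and> card Z \<le> card (\<Union>i\<in>Z. S'' i) + d"
      using fixer_reduces_deficiency[OF Suc.prems] by blast
    show ?thesis
    proof (rule fixer_wins.round[OF move])
      fix S'' assume r: "breaker_reply I t i x y S' S''"
      show "fixer_wins I P t S''"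
        using Suc.prems(1,2,4) reply[OF r] breaker_reply_subset_pot[OF move r Suc.prems(3)]
        by (intro Suc.IH) auto
    qed
  qed
qed

theorem theorem1p2:
  fixes I :: "'i set" and S :: "'i \<Rightarrow> 'a set" and P :: "'a set" and t :: nat
  assumes "finite I"
    and "\<And>i. i \<in> I \<Longrightarrow> finite (S i)"
    and "finite P"
    and "(\<Union>i\<in>I. S i) \<subseteq> P"
    and "card P \<ge> card I"
    and "t \<in> {1..card I - 1}"
  shows "fixer_wins I P t S \<longleftrightarrow>
    (\<forall>W \<subseteq> I. int (card (\<Union>i\<in>W. S i)) \<ge> int (card W) - t_value t S W)"
proof -
  have SP: "\<And>i. i \<in> I \<Longrightarrow> S i \<subseteq> P" and t: "t \<ge> 1" using assms(4,6) by auto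
  have iff: "int (card (\<Union>i\<in>W. S i)) \<ge> int (card W) - t_value t S W \<longleftrightarrow> card W \<le> weight t P S W"
    if "W \<subseteq> I" for W
  proof -
    have "(\<Union>i\<in>W. S i) \<subseteq> P" using that assms(4) by blast
    from weight_eq_card_plus_t_value[OF assms(3) this, of t] show ?thesis by linarith
  qed
  have "fixer_wins I P t S \<longleftrightarrow> (\<forall>W \<subseteq> I. card W \<le> weight t P S W)"
  proof
    assume "fixer_wins I P t S"
    then show "\<forall>W \<subseteq> I. card W \<le> weight t P S W"
      using fixer_wins_imp_weight_ge[OF _ assms(1,3) t SP] by simp
  next
    assume "\<forall>W \<subseteq> I. card W \<le> weight t P S W"
    \<comment> \<open>\<open>card I\<close> is a crude initial bound on the deficiency, enough to
      start the induction.\<close>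
    moreover have "card W \<le> card (\<Union>i\<in>W. S i) + card I" if "W \<subseteq> I" for W
      using card_mono[OF assms(1) that] by linarith
    ultimately show "fixer_wins I P t S"
      by (intro weight_ge_imp_fixer_wins[OF assms(1,3) SP assms(5)]) auto
  qed
  then show ?thesis using iff by simp
qed

end
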